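(* Let $\mathcal{A}=(E,R,\partial)$ and $\mathcal{A}'=(E',R',\partial')$ be two arbitrary crossed modules of commutative algebras. There is a groupoid $\mathrm{HOM}(\mathcal{A},\mathcal{A}')$ whose objects are the crossed module maps $\mathcal{A}\to\mathcal{A}'$ and whose morphisms $f\to g$ are the homotopies $(f_0,s)$ connecting $f$ to $g$ (with composition given by addition of derivations, identities given by zero derivations, and inverses given by $s\mapsto -s$). In particular, the relation on crossed module morphisms $\mathcal{A}\to\mathcal{A}'$ given by $$f\simeq g\iff\text{there exists an } f_0\text{-derivation } s\text{ connecting } f\text{ with } g$$ is an equivalence relation.
   Context: $\kappa$ is a fixed commutative ring. All algebras are commutative associative $\kappa$-algebras, not assumed unital; algebra maps are $\kappa$-linear multiplicative maps. An action of an algebra $R$ on an algebra $M$ is a $\kappa$-bilinear map $(r,m)\mapsto r\blacktriangleright m\in M$ with $r\blacktriangleright(mm')=(r\blacktriangleright m)m'=m(r\blacktriangleright m')$ and $(rr')\blacktriangleright m=r\blacktriangleright(r'\blacktriangleright m)$. A crossed module $(E,R,\partial)$ is an algebra map $\partial\colon E\to R$ with an action $\blacktriangleright$ of $R$ on $E$ such that $\partial(r\blacktriangleright e)=r\,\partial(e)$ and $\partial(e)\blacktriangleright e'=ee'$ for all $r\in R$, $e,e'\in E$. A crossed module morphism $f=(f_1,f_0)\colon(E,R,\partial)\to(E',R',\partial')$ is a pair of algebra maps $f_1\colon E\to E'$, $f_0\colon R\to R'$ with $\partial' f_1=f_0\partial$ and $f_1(r\blacktriangleright e)=f_0(r)\blacktriangleright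 f_1(e)$. An $f_0$-derivation is a $\kappa$-linear map $s\colon R\to E'$ with $s(rr')=f_0(r)\blacktriangleright s(r')+f_0(r')\blacktriangleright s(r)+s(r)s(r')$ for all $r,r'\in R$. It connects $f$ to $g$ (and $(f_0,s)$ is then called a homotopy from $f$ to $g$) if $g_0=f_0+\partial'\circ s$ and $g_1=f_1+s\circ\partial$. *)

theory Defs
  imports "HOL-Algebra.Module" "HOL-Library.FuncSet"
begin

text \<open>The locale \<open>algebra\<close> of HOL-Algebra makes the algebra a unital ring. Here an algebra need
  not have a unit, so multiplication is axiomatised on top of a module over the commutative
  ring \<open>K\<close>. The field \<open>one\<close> of the record \<open>M\<close> is unconstrained and never used.\<close>

locale comm_alg = module K M for K (structure) and M (structure) +
  assumes mult_closed: "\<lbrakk>x \<in> carrier M; y \<in> carrier M\<rbrakk> \<Longrightarrow> x \<otimes>\<^bsub>M\<^esub> y \<in> carrier M"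
    and mult_assoc: "\<lbrakk>x \<in> carrier M; y \<in> carrier M; z \<in> carrier M\<rbrakk> \<Longrightarrow>
      (x \<otimes>\<^bsub>M\<^esub> y) \<otimes>\<^bsub>M\<^esub> z = x \<otimes>\<^bsub>M\<^esub> (y \<otimes>\<^bsub>M\<^esub> z)"
    and mult_comm: "\<lbrakk>x \<in> carrier M; y \<in> carrier M\<rbrakk> \<Longrightarrow> x \<otimes>\<^bsub>M\<^esub> y = y \<otimes>\<^bsub>M\<^esub> x"
    and mult_distr: "\<lbrakk>x \<in> carrier M; y \<in> carrier M; z \<in> carrier M\<rbrakk> \<Longrightarrow>
      (x \<oplus>\<^bsub>M\<^esub> y) \<otimes>\<^bsub>M\<^esub> z = x \<otimes>\<^bsub>M\<^esub> z \<oplus>\<^bsub>M\<^esub> y \<otimes>\<^bsub>M\<^esub> z"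
    and smult_mult: "\<lbrakk>k \<in> carrier K; x \<in> carrier M; y \<in> carrier M\<rbrakk> \<Longrightarrow>
      (k \<odot>\<^bsub>M\<^esub> x) \<otimes>\<^bsub>M\<^esub> y = k \<odot>\<^bsub>M\<^esub> (x \<otimes>\<^bsub>M\<^esub> y)"

definition linear_maps ::
  "('k, 'c) ring_scheme \<Rightarrow> ('k, 'a) module \<Rightarrow> ('k, 'b) module \<Rightarrow> ('a \<Rightarrow> 'b) set"
  where "linear_maps K M N = {h \<in> carrier M \<rightarrow> carrier N.
    (\<forall>x\<in>carrier M. \<forall>y\<in>carrier M. h (x \<oplus>\<^bsub>M\<^esub> y) = h x \<oplus>\<^bsub>N\<^esub> h y) \<and>
    (\<forall>k\<in>carrier K. \<forall>x\<in>carrier M. h (k \<odot>\<^bsub>M\<^esub> x) = k \<odot>\<^bsub>N\<^esub> h x)}"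

definition alg_maps ::
  "('k, 'c) ring_scheme \<Rightarrow> ('k, 'a) module \<Rightarrow> ('k, 'b) module \<Rightarrow> ('a \<Rightarrow> 'b) set"
  where "alg_maps K M N = {h \<in> linear_maps K M N.
    \<forall>x\<in>carrier M. \<forall>y\<in>carrier M. h (x \<otimes>\<^bsub>M\<^esub> y) = h x \<otimes>\<^bsub>N\<^esub> h y}"

locale alg_action =
  R: comm_alg K R + M: comm_alg K M for K and R and M +
  fixes act :: "'r \<Rightarrow> 'm \<Rightarrow> 'm"  (infixr \<open>\<rhd>\<close> 75)
  assumes act_linear_right: "r \<in> carrier R \<Longrightarrow> (\<lambda>m. r \<rhd> m) \<in> linear_maps K M M"
    and act_linear_left: "m \<in> carrier M \<Longrightarrow> (\<lambda>r. r \<rhd> m) \<in> linear_maps K R M"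
    and act_mult_left: "\<lbrakk>r \<in> carrier R; m \<in> carrier M; m' \<in> carrier M\<rbrakk> \<Longrightarrow>
      r \<rhd> (m \<otimes>\<^bsub>M\<^esub> m') = (r \<rhd> m) \<otimes>\<^bsub>M\<^esub> m'"
    and act_mult_right: "\<lbrakk>r \<in> carrier R; m \<in> carrier M; m' \<in> carrier M\<rbrakk> \<Longrightarrow>
      r \<rhd> (m \<otimes>\<^bsub>M\<^esub> m') = m \<otimes>\<^bsub>M\<^esub> (r \<rhd> m')"
    and act_assoc: "\<lbrakk>r \<in> carrier R; r' \<in> carrier R; m \<in> carrier M\<rbrakk> \<Longrightarrow>
      (r \<otimes>\<^bsub>R\<^esub> r') \<rhd> m = r \<rhd> (r' \<rhd> m)"

record ('k, 'e, 'r) xmod =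
  Top :: "('k, 'e) module"
  Base :: "('k, 'r) module"
  bdry :: "'e \<Rightarrow> 'r"
  xact :: "'r \<Rightarrow> 'e \<Rightarrow> 'e"

locale crossed_module =
  alg_action K "Base A" "Top A" "xact A"
  for K and A :: "('k, 'e, 'r) xmod" +
  assumes bdry_map: "bdry A \<in> alg_maps K (Top A) (Base A)"
    and bdry_act: "\<lbrakk>r \<in> carrier (Base A); e \<in> carrier (Top A)\<rbrakk> \<Longrightarrow>
      bdry A (xact A r e) = r \<otimes>\<^bsub>Base A\<^esub> bdry A e"
    and peiffer: "\<lbrakk>e \<in> carrier (Top A); e' \<in> carrier (Top A)\<rbrakk> \<Longrightarrow>
      xact A (bdry A e) e' = e \<otimes>\<^bsub>Top A\<^esub> e'"

text \<open>A morphism is the pair \<open>(f1, f0)\<close>. Here and for derivations, maps are taken to be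
  \<open>extensional\<close> (\<open>undefined\<close> off the carrier), so that HOL equality of such maps is equality of
  maps between the carriers.\<close>

definition xmod_maps ::
  "('k, 'c) ring_scheme \<Rightarrow> ('k, 'e, 'r) xmod \<Rightarrow> ('k, 'e', 'r') xmod \<Rightarrow> (('e \<Rightarrow> 'e') \<times> ('r \<Rightarrow> 'r')) set"
  where "xmod_maps K A A' = {(f1, f0).
    f1 \<in> alg_maps K (Top A) (Top A') \<inter> extensional (carrier (Top A)) \<and>
    f0 \<in> alg_maps K (Base A) (Base A') \<inter> extensional (carrier (Base A)) \<and>
    (\<forall>e\<in>carrier (Top A). bdry A' (f1 e) = f0 (bdry A e)) \<and>
    (\<forall>r\<in>carrier (Base A). \<forall>e\<in>carrier (Top A). f1 (xact A r e) = xact A' (f0 r) (f1 e))}"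

definition derivations ::
  "('k, 'c) ring_scheme \<Rightarrow> ('k, 'e, 'r) xmod \<Rightarrow> ('k, 'e', 'r') xmod \<Rightarrow> ('r \<Rightarrow> 'r') \<Rightarrow> ('r \<Rightarrow> 'e') set"
  where "derivations K A A' f0 =
    {s \<in> linear_maps K (Base A) (Top A') \<inter> extensional (carrier (Base A)).
      \<forall>r\<in>carrier (Base A). \<forall>r'\<in>carrier (Base A).
        s (r \<otimes>\<^bsub>Base A\<^esub> r') =
          xact A' (f0 r) (s r') \<oplus>\<^bsub>Top A'\<^esub> xact A' (f0 r') (s r) \<oplus>\<^bsub>Top A'\<^esub> s r \<otimes>\<^bsub>Top A'\<^esub> s r'}"

definition connects ::
  "('k, 'e, 'r) xmod \<Rightarrow> ('k, 'e', 'r') xmod \<Rightarrow> ('r \<Rightarrow> 'e') \<Rightarrow>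
    ('e \<Rightarrow> 'e') \<times> ('r \<Rightarrow> 'r') \<Rightarrow> ('e \<Rightarrow> 'e') \<times> ('r \<Rightarrow> 'r') \<Rightarrow> bool"
  where "connects A A' s f g \<longleftrightarrow>
    (\<forall>r\<in>carrier (Base A). snd g r = snd f r \<oplus>\<^bsub>Base A'\<^esub> bdry A' (s r)) \<and>
    (\<forall>e\<in>carrier (Top A). fst g e = fst f e \<oplus>\<^bsub>Top A'\<^esub> s (bdry A e))"

definition homotopies ::
  "('k, 'c) ring_scheme \<Rightarrow> ('k, 'e, 'r) xmod \<Rightarrow> ('k, 'e', 'r') xmod \<Rightarrow>
    ('e \<Rightarrow> 'e') \<times> ('r \<Rightarrow> 'r') \<Rightarrow> ('e \<Rightarrow> 'e') \<times> ('r \<Rightarrow> 'r') \<Rightarrow> (('r \<Rightarrow> 'r') \<times> ('r \<Rightarrow> 'e')) set"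
  where "homotopies K A A' f g =
    {(f0, s). f0 = snd f \<and> s \<in> derivations K A A' f0 \<and> connects A A' s f g}"

text \<open>Groupoids are given by hom-sets \<open>Hom f g\<close> indexed by source and target; these need not be
  disjoint (a homotopy \<open>(f0, s)\<close> does not determine the component \<open>f1\<close> of its source), so the
  operations take the objects as arguments. \<open>Comp f g h\<close> composes in diagrammatic order.\<close>

record ('o, 'm) groupoid_data =
  Ob :: "'o set"
  Hom :: "'o \<Rightarrow> 'o \<Rightarrow> 'm set"
  Comp :: "'o \<Rightarrow> 'o \<Rightarrow> 'o \<Rightarrow> 'm \<Rightarrow> 'm \<Rightarrow> 'm"
  Ident :: "'o \<Rightarrow> 'm"
  Inverse :: "'o \<Rightarrow> 'o \<Rightarrow> 'm \<Rightarrow> 'm"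

locale groupoid =
  fixes C :: "('o, 'm) groupoid_data"
  assumes Comp_closed: "\<lbrakk>f \<in> Ob C; g \<in> Ob C; h \<in> Ob C; a \<in> Hom C f g; b \<in> Hom C g h\<rbrakk> \<Longrightarrow>
      Comp C f g h a b \<in> Hom C f h"
    and Comp_assoc: "\<lbrakk>f \<in> Ob C; g \<in> Ob C; h \<in> Ob C; i \<in> Ob C;
        a \<in> Hom C f g; b \<in> Hom C g h; c \<in> Hom C h i\<rbrakk> \<Longrightarrow>
      Comp C f h i (Comp C f g h a b) c = Comp C f g i a (Comp C g h i b c)"
    and Ident_closed: "f \<in> Ob C \<Longrightarrow> Ident C f \<in> Hom C f f"
    and Ident_left: "\<lbrakk>f \<in> Ob C; g \<in> Ob C; a \<in> Hom C f g\<rbrakk> \<Longrightarrow> Comp C f f g (Ident C f) a = a"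
    and Ident_right: "\<lbrakk>f \<in> Ob C; g \<in> Ob C; a \<in> Hom C f g\<rbrakk> \<Longrightarrow> Comp C f g g a (Ident C g) = a"
    and Inverse_closed: "\<lbrakk>f \<in> Ob C; g \<in> Ob C; a \<in> Hom C f g\<rbrakk> \<Longrightarrow> Inverse C f g a \<in> Hom C g f"
    and Inverse_right: "\<lbrakk>f \<in> Ob C; g \<in> Ob C; a \<in> Hom C f g\<rbrakk> \<Longrightarrow>
      Comp C f g f a (Inverse C f g a) = Ident C f"
    and Inverse_left: "\<lbrakk>f \<in> Ob C; g \<in> Ob C; a \<in> Hom C f g\<rbrakk> \<Longrightarrow>
      Comp C g f g (Inverse C f g a) a = Ident C g"

definition HOM ::
  "('k, 'c) ring_scheme \<Rightarrow> ('k, 'e, 'r) xmod \<Rightarrow> ('k, 'e', 'r') xmod \<Rightarrow>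
    (('e \<Rightarrow> 'e') \<times> ('r \<Rightarrow> 'r'), ('r \<Rightarrow> 'r') \<times> ('r \<Rightarrow> 'e')) groupoid_data"
  where "HOM K A A' = \<lparr>
    Ob = xmod_maps K A A',
    Hom = homotopies K A A',
    Comp = (\<lambda>f g h (f0, s) (g0, t). (f0, \<lambda>r\<in>carrier (Base A). s r \<oplus>\<^bsub>Top A'\<^esub> t r)),
    Ident = (\<lambda>f. (snd f, \<lambda>r\<in>carrier (Base A). \<zero>\<^bsub>Top A'\<^esub>)),
    Inverse = (\<lambda>f g (f0, s). (snd g, \<lambda>r\<in>carrier (Base A). \<ominus>\<^bsub>Top A'\<^esub> s r))\<rparr>"

definition homotopy_rel ::
  "('k, 'c) ring_scheme \<Rightarrow> ('k, 'e, 'r) xmod \<Rightarrow> ('k, 'e', 'r') xmod \<Rightarrow>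
    ((('e \<Rightarrow> 'e') \<times> ('r \<Rightarrow> 'r')) \<times> (('e \<Rightarrow> 'e') \<times> ('r \<Rightarrow> 'r'))) set"
  where "homotopy_rel K A A' = {(f, g). f \<in> xmod_maps K A A' \<and> g \<in> xmod_maps K A A' \<and>
    (\<exists>s \<in> derivations K A A' (snd f). connects A A' s f g)}"

end

theory Submission
  imports Defs "HOL-Algebra.AbelCoset"
begin

text \<open>
  Everything rests on one formula. If \<open>s\<close> connects \<open>f\<close> to \<open>g\<close>, then
  \<open>g\<^sub>0 r = f\<^sub>0 r + \<partial>' (s r)\<close>, and the Peiffer identity turns the action of the second
  summand into a product: \<open>g\<^sub>0 r \<rhd> x = f\<^sub>0 r \<rhd> x + s r \<cdot> x\<close> (lemma \<open>act_target\<close>).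

  Let \<open>t\<close> be a \<open>g\<^sub>0\<close>-derivation. Rewritten with this formula, its Leibniz rule reads
  \<open>t (r r') = f\<^sub>0 r \<rhd> t r' + f\<^sub>0 r' \<rhd> t r + s r \<cdot> t r' + s r' \<cdot> t r + t r \<cdot> t r'\<close>.
  Adding the rule for \<open>s\<close>, which contributes the quadratic term \<open>s r \<cdot> s r'\<close>, the two mixed
  products are exactly those needed to complete the square-like expression
  \<open>(s r + t r) \<cdot> (s r' + t r')\<close>; so \<open>s + t\<close> is again an \<open>f\<^sub>0\<close>-derivation
  (lemma \<open>derivation_add\<close>).

  For inverses, the negated rule for \<open>s\<close> has quadratic term \<open>- s r \<cdot> s r'\<close>, whereas a
  derivation \<open>- s\<close> needs \<open>+ s r \<cdot> s r'\<close>. Replacing the two actions of \<open>f\<^sub>0\<close> by actions of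
  \<open>g\<^sub>0\<close> supplies the difference \<open>2 s r \<cdot> s r'\<close>, so \<open>- s\<close> is a derivation over the target
  \<open>g\<^sub>0\<close> (lemma \<open>derivation_neg\<close>).

  The groupoid laws then hold because homotopies compose by pointwise addition in an abelian
  group. Finally, in any groupoid the existence of a morphism between two objects is an
  equivalence relation on the objects (lemma \<open>equiv_connected\<close>); for \<open>HOM\<close> this is
  the homotopy relation.
\<close>

section \<open>Linear maps\<close>

lemma linear_mapsI:
  assumes "\<And>x. x \<in> carrier M \<Longrightarrow> h x \<in> carrier N"
    and "\<And>x y. \<lbrakk>x \<in> carrier M; y \<in> carrier M\<rbrakk> \<Longrightarrow> h (x \<oplus>\<^bsub>M\<^esub> y) = h x \<oplus>\<^bsub>N\<^esub> h y"
    and "\<And>k x. \<lbrakk>k \<in> carrier K; x \<in> carrier M\<rbrakk> \<Longrightarrow> h (k \<odot>\<^bsub>M\<^esub> x) = k \<odot>\<^bsub>N\<^esub> h x"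
  shows "h \<in> linear_maps K M N"
  using assms by (auto simp: linear_maps_def)

lemma linear_maps_closed: "\<lbrakk>h \<in> linear_maps K M N; x \<in> carrier M\<rbrakk> \<Longrightarrow> h x \<in> carrier N"
  and linear_maps_add: "\<lbrakk>h \<in> linear_maps K M N; x \<in> carrier M; y \<in> carrier M\<rbrakk> \<Longrightarrow>
    h (x \<oplus>\<^bsub>M\<^esub> y) = h x \<oplus>\<^bsub>N\<^esub> h y"
  and linear_maps_smult: "\<lbrakk>h \<in> linear_maps K M N; k \<in> carrier K; x \<in> carrier M\<rbrakk> \<Longrightarrow>
    h (k \<odot>\<^bsub>M\<^esub> x) = k \<odot>\<^bsub>N\<^esub> h x"
  by (auto simp: linear_maps_def)

lemma linear_maps_group_hom:
  assumes "abelian_group M" and "abelian_group N" and "h \<in> linear_maps K M N"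
  shows "abelian_group_hom M N h"
  using assms
  by (intro abelian_group_homI)
     (auto simp: group_hom_def group_hom_axioms_def hom_def abelian_group.a_group
        linear_maps_closed linear_maps_add)

context
  fixes K :: "('k, 'c) ring_scheme" and M :: "('k, 'a) module" and N :: "('k, 'b) module"
  assumes module_M: "module K M" and module_N: "module K N"
begin

interpretation M: module K M by (fact module_M)
interpretation N: module K N by (fact module_N)

lemma linear_maps_pointwise_zero: "(\<lambda>x\<in>carrier M. \<zero>\<^bsub>N\<^esub>) \<in> linear_maps K M N"
  by (rule linear_mapsI) auto

lemma linear_maps_pointwise_add:
  assumes "s \<in> linear_maps K M N" and "t \<in> linear_maps K M N"
  shows "(\<lambda>x\<in>carrier M. s x \<oplus>\<^bsub>N\<^esub> t x) \<in> linear_maps K M N"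
  using assms
  by (intro linear_mapsI)
     (auto simp: linear_maps_closed linear_maps_add linear_maps_smult N.smult_r_distr N.a_ac)

lemma linear_maps_pointwise_minus:
  assumes "s \<in> linear_maps K M N"
  shows "(\<lambda>x\<in>carrier M. \<ominus>\<^bsub>N\<^esub> s x) \<in> linear_maps K M N"
  using assms
  by (intro linear_mapsI)
     (auto simp: linear_maps_closed linear_maps_add linear_maps_smult N.smult_r_minus N.minus_add)

end

section \<open>Arithmetic in non-unital algebras\<close>

lemma (in comm_alg) mult_distl:
  assumes "x \<in> carrier M" and "y \<in> carrier M" and "z \<in> carrier M"
  shows "x \<otimes>\<^bsub>M\<^esub> (y \<oplus>\<^bsub>M\<^esub> z) = x \<otimes>\<^bsub>M\<^esub> y \<oplus>\<^bsub>M\<^esub> x \<otimes>\<^bsub>M\<^esub> z"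
  using mult_distr[of y z x] assms by (simp add: mult_comm[of x])

text \<open>The sign rules of a ring hold without a unit, since an additive map preserves negatives.\<close>

lemma (in comm_alg) mult_group_hom:
  assumes "x \<in> carrier M"
  shows "abelian_group_hom M M (\<lambda>y. x \<otimes>\<^bsub>M\<^esub> y)"
  using assms
  by (intro abelian_group_homI)
     (auto simp: group_hom_def group_hom_axioms_def hom_def M.a_group M.abelian_group_axioms mult_closed
        mult_distl)

lemma (in comm_alg) mult_minus_right:
  assumes "x \<in> carrier M" and "y \<in> carrier M"
  shows "x \<otimes>\<^bsub>M\<^esub> (\<ominus>\<^bsub>M\<^esub> y) = \<ominus>\<^bsub>M\<^esub> (x \<otimes>\<^bsub>M\<^esub> y)"
  using abelian_group_hom.hom_a_inv[OF mult_group_hom] assms by simp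

lemma (in comm_alg) mult_minus_left:
  assumes "x \<in> carrier M" and "y \<in> carrier M"
  shows "(\<ominus>\<^bsub>M\<^esub> x) \<otimes>\<^bsub>M\<^esub> y = \<ominus>\<^bsub>M\<^esub> (x \<otimes>\<^bsub>M\<^esub> y)"
  using mult_minus_right[of y x] assms by (simp add: mult_comm[of _ y])

section \<open>Two crossed modules\<close>

locale crossed_module_pair =
  A: crossed_module K A + B: crossed_module K B
  for K :: "('k, 'c) ring_scheme" and A :: "('k, 'e, 'r) xmod" and B :: "('k, 'e', 'r') xmod"
begin

abbreviation add (infixl \<open>\<^bold>+\<close> 65) where "x \<^bold>+ y \<equiv> x \<oplus>\<^bsub>Top B\<^esub> y"
abbreviation mult (infixl \<open>\<^bold>*\<close> 70) where "x \<^bold>* y \<equiv> x \<otimes>\<^bsub>Top B\<^esub> y"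
abbreviation neg (\<open>\<^bold>- _\<close> [81] 80) where "\<^bold>- x \<equiv> \<ominus>\<^bsub>Top B\<^esub> x"
abbreviation act (infixr \<open>\<rhd>\<close> 75) where "r \<rhd> x \<equiv> xact B r x"

lemma bdry_source_closed: "e \<in> carrier (Top A) \<Longrightarrow> bdry A e \<in> carrier (Base A)"
  using A.bdry_map by (auto simp: alg_maps_def linear_maps_closed)

lemma bdry_closed: "x \<in> carrier (Top B) \<Longrightarrow> bdry B x \<in> carrier (Base B)"
  and bdry_group_hom: "abelian_group_hom (Top B) (Base B) (bdry B)"
  using B.bdry_map
  by (auto simp: alg_maps_def linear_maps_closed
      intro: linear_maps_group_hom B.R.abelian_group_axioms B.M.abelian_group_axioms)

lemma act_closed: "\<lbrakk>r \<in> carrier (Base B); x \<in> carrier (Top B)\<rbrakk> \<Longrightarrow> r \<rhd> x \<in> carrier (Top B)"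
  using B.act_linear_right linear_maps_closed by fastforce

lemma act_add_right: "\<lbrakk>r \<in> carrier (Base B); x \<in> carrier (Top B); y \<in> carrier (Top B)\<rbrakk> \<Longrightarrow>
    r \<rhd> (x \<^bold>+ y) = r \<rhd> x \<^bold>+ r \<rhd> y"
  using B.act_linear_right linear_maps_add by fastforce

lemma act_add_left: "\<lbrakk>r \<in> carrier (Base B); r' \<in> carrier (Base B); x \<in> carrier (Top B)\<rbrakk> \<Longrightarrow>
    (r \<oplus>\<^bsub>Base B\<^esub> r') \<rhd> x = r \<rhd> x \<^bold>+ r' \<rhd> x"
  using linear_maps_add[OF B.act_linear_left] by simp

lemma act_group_hom:
  assumes "r \<in> carrier (Base B)"
  shows "abelian_group_hom (Top B) (Top B) (\<lambda>x. r \<rhd> x)"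
  using B.act_linear_right[OF assms]
  by (intro linear_maps_group_hom B.M.abelian_group_axioms)

lemma act_zero: "r \<in> carrier (Base B) \<Longrightarrow> r \<rhd> \<zero>\<^bsub>Top B\<^esub> = \<zero>\<^bsub>Top B\<^esub>"
  using abelian_group_hom.hom_zero[OF act_group_hom] by simp

lemma act_minus:
  "\<lbrakk>r \<in> carrier (Base B); x \<in> carrier (Top B)\<rbrakk> \<Longrightarrow> r \<rhd> (\<^bold>- x) = \<^bold>- (r \<rhd> x)"
  using abelian_group_hom.hom_a_inv[OF act_group_hom] by simp

lemma xmod_maps_closed:
  assumes "f \<in> xmod_maps K A B"
  shows "r \<in> carrier (Base A) \<Longrightarrow> snd f r \<in> carrier (Base B)"
    and "e \<in> carrier (Top A) \<Longrightarrow> fst f e \<in> carrier (Top B)"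
  using assms by (auto simp: xmod_maps_def alg_maps_def linear_maps_closed)

lemma derivationsD:
  assumes "s \<in> derivations K A B f0"
  shows "s \<in> linear_maps K (Base A) (Top B)"
    and "s \<in> extensional (carrier (Base A))"
    and "r \<in> carrier (Base A) \<Longrightarrow> s r \<in> carrier (Top B)"
    and "\<lbrakk>r \<in> carrier (Base A); r' \<in> carrier (Base A)\<rbrakk> \<Longrightarrow>
      s (r \<otimes>\<^bsub>Base A\<^esub> r') = f0 r \<rhd> s r' \<^bold>+ f0 r' \<rhd> s r \<^bold>+ s r \<^bold>* s r'"
  using assms by (auto simp: derivations_def linear_maps_closed)

lemma connects_base: "\<lbrakk>connects A B s f g; r \<in> carrier (Base A)\<rbrakk> \<Longrightarrow>
    snd g r = snd f r \<oplus>\<^bsub>Base B\<^esub> bdry B (s r)"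
  and connects_top: "\<lbrakk>connects A B s f g; e \<in> carrier (Top A)\<rbrakk> \<Longrightarrow>
    fst g e = fst f e \<^bold>+ s (bdry A e)"
  by (auto simp: connects_def)

text \<open>The boundary part of the target acts by multiplication, by the Peiffer identity.\<close>

lemma act_target:
  assumes f: "f \<in> xmod_maps K A B" and s: "s \<in> derivations K A B (snd f)"
    and c: "connects A B s f g" and "r \<in> carrier (Base A)" "x \<in> carrier (Top B)"
  shows "snd g r \<rhd> x = snd f r \<rhd> x \<^bold>+ s r \<^bold>* x"
  using assms
  by (simp add: connects_base[OF c] act_add_left xmod_maps_closed derivationsD(3)[OF s]
      bdry_closed B.peiffer)

section \<open>Addition and negation of derivations\<close>

lemma derivation_zero:
  assumes "f \<in> xmod_maps K A B"
  shows "(\<lambda>r\<in>carrier (Base A). \<zero>\<^bsub>Top B\<^esub>) \<in> derivations K A B (snd f)"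
  using linear_maps_pointwise_zero[OF A.R.module_axioms B.M.module_axioms] assms
    abelian_group_hom.hom_zero[OF B.M.mult_group_hom]
  by (auto simp: derivations_def A.R.mult_closed act_zero xmod_maps_closed)

text \<open>The mixed products in \<open>(s r + t r) \<cdot> (s r' + t r')\<close> account for the difference between
  the actions of the target \<open>g\<close> in the rule for \<open>t\<close> and those of \<open>f\<close> in the rule for the sum.\<close>

lemma derivation_add:
  assumes f: "f \<in> xmod_maps K A B"
    and s: "s \<in> derivations K A B (snd f)" and t: "t \<in> derivations K A B (snd g)"
    and c: "connects A B s f g"
  shows "(\<lambda>r\<in>carrier (Base A). s r \<^bold>+ t r) \<in> derivations K A B (snd f)"
proof -
  note closed = derivationsD(3)[OF s] derivationsD(3)[OF t] xmod_maps_closed(1)[OF f]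
    act_closed B.M.mult_closed
  have "s (r \<otimes>\<^bsub>Base A\<^esub> r') \<^bold>+ t (r \<otimes>\<^bsub>Base A\<^esub> r') =
      snd f r \<rhd> (s r' \<^bold>+ t r') \<^bold>+ snd f r' \<rhd> (s r \<^bold>+ t r) \<^bold>+ (s r \<^bold>+ t r) \<^bold>* (s r' \<^bold>+ t r')"
    if r: "r \<in> carrier (Base A)" "r' \<in> carrier (Base A)" for r r'
  proof -
    have "(s r \<^bold>+ t r) \<^bold>* (s r' \<^bold>+ t r') = s r \<^bold>* s r' \<^bold>+ s r \<^bold>* t r' \<^bold>+ s r' \<^bold>* t r \<^bold>+ t r \<^bold>* t r'"
      using r by (simp add: closed B.M.mult_distr B.M.mult_distl
          B.M.mult_comm[of "s r'" "t r"] B.M.M.a_ac)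
    then show ?thesis
      using r by (simp add: closed derivationsD(4)[OF s] derivationsD(4)[OF t]
          act_target[OF f s c] act_add_right B.M.M.a_ac)
  qed
  then show ?thesis
    using linear_maps_pointwise_add[OF A.R.module_axioms B.M.module_axioms]
      derivationsD(1)[OF s] derivationsD(1)[OF t]
    by (simp add: derivations_def A.R.mult_closed)
qed

text \<open>Each of the two actions of the target contributes \<open>- s r \<cdot> s r'\<close>; the product
  \<open>(- s r) \<cdot> (- s r')\<close> cancels one of these, and the other is the negated quadratic term of
  \<open>s\<close>.\<close>

lemma derivation_neg:
  assumes f: "f \<in> xmod_maps K A B" and s: "s \<in> derivations K A B (snd f)"
    and c: "connects A B s f g"
  shows "(\<lambda>r\<in>carrier (Base A). \<^bold>- s r) \<in> derivations K A B (snd g)"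
proof -
  note closed = derivationsD(3)[OF s] xmod_maps_closed(1)[OF f] act_closed B.M.mult_closed
  have "\<^bold>- s (r \<otimes>\<^bsub>Base A\<^esub> r') =
      snd g r \<rhd> (\<^bold>- s r') \<^bold>+ snd g r' \<rhd> (\<^bold>- s r) \<^bold>+ (\<^bold>- s r) \<^bold>* (\<^bold>- s r')"
    if r: "r \<in> carrier (Base A)" "r' \<in> carrier (Base A)" for r r'
  proof -
    let ?x = "snd f r \<rhd> s r'" and ?y = "snd f r' \<rhd> s r" and ?m = "s r \<^bold>* s r'"
    have "snd g r \<rhd> (\<^bold>- s r') = \<^bold>- ?x \<^bold>+ \<^bold>- ?m" and "snd g r' \<rhd> (\<^bold>- s r) = \<^bold>- ?y \<^bold>+ \<^bold>- ?m"
      and "(\<^bold>- s r) \<^bold>* (\<^bold>- s r') = ?m"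
      using r by (simp_all add: closed act_target[OF f s c] act_minus B.M.mult_minus_right
          B.M.mult_minus_left B.M.mult_comm[of "s r'" "s r"])
    then have "snd g r \<rhd> (\<^bold>- s r') \<^bold>+ snd g r' \<rhd> (\<^bold>- s r) \<^bold>+ (\<^bold>- s r) \<^bold>* (\<^bold>- s r') =
        (\<^bold>- ?x \<^bold>+ \<^bold>- ?m) \<^bold>+ (\<^bold>- ?y \<^bold>+ \<^bold>- ?m) \<^bold>+ ?m"
      by simp
    also have "\<dots> = (\<^bold>- ?x \<^bold>+ \<^bold>- ?m) \<^bold>+ \<^bold>- ?y"
      using r by (simp add: closed B.M.M.a_assoc B.M.M.l_neg)
    also have "\<dots> = \<^bold>- s (r \<otimes>\<^bsub>Base A\<^esub> r')"
      using r by (simp add: closed derivationsD(4)[OF s] B.M.M.minus_add B.M.M.a_ac)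
    finally show ?thesis
      by simp
  qed
  then show ?thesis
    using linear_maps_pointwise_minus[OF A.R.module_axioms B.M.module_axioms]
      derivationsD(1)[OF s]
    by (simp add: derivations_def A.R.mult_closed)
qed

lemma connects_zero:
  assumes "f \<in> xmod_maps K A B"
  shows "connects A B (\<lambda>r\<in>carrier (Base A). \<zero>\<^bsub>Top B\<^esub>) f f"
  using assms abelian_group_hom.hom_zero[OF bdry_group_hom]
  by (simp add: connects_def bdry_source_closed xmod_maps_closed)

lemma connects_add:
  assumes f: "f \<in> xmod_maps K A B"
    and s: "s \<in> derivations K A B (snd f)" and t: "t \<in> derivations K A B (snd g)"
    and c: "connects A B s f g" and d: "connects A B t g h"
  shows "connects A B (\<lambda>r\<in>carrier (Base A). s r \<^bold>+ t r) f h"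
  using abelian_group_hom.hom_add[OF bdry_group_hom]
  by (simp add: connects_def connects_base[OF c] connects_base[OF d] connects_top[OF c]
      connects_top[OF d] bdry_source_closed bdry_closed xmod_maps_closed[OF f]
      derivationsD(3)[OF s] derivationsD(3)[OF t] B.M.M.a_assoc B.R.M.a_assoc)

lemma connects_neg:
  assumes f: "f \<in> xmod_maps K A B"
    and s: "s \<in> derivations K A B (snd f)" and c: "connects A B s f g"
  shows "connects A B (\<lambda>r\<in>carrier (Base A). \<^bold>- s r) g f"
  using abelian_group_hom.hom_a_inv[OF bdry_group_hom]
  by (simp add: connects_def connects_base[OF c] connects_top[OF c] bdry_source_closed
      bdry_closed xmod_maps_closed[OF f] derivationsD(3)[OF s]
      B.M.M.a_assoc B.R.M.a_assoc B.M.M.r_neg B.R.M.r_neg)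

section \<open>The groupoid of homotopies\<close>

lemma homotopiesE:
  assumes "a \<in> homotopies K A B f g"
  obtains s where "a = (snd f, s)" "s \<in> derivations K A B (snd f)" "connects A B s f g"
  using assms by (auto simp: homotopies_def)

theorem groupoid_HOM: "groupoid (HOM K A B)"
proof
  fix f g h a b
  assume "f \<in> Ob (HOM K A B)" "g \<in> Ob (HOM K A B)" "h \<in> Ob (HOM K A B)"
    "a \<in> Hom (HOM K A B) f g" "b \<in> Hom (HOM K A B) g h"
  then show "Comp (HOM K A B) f g h a b \<in> Hom (HOM K A B) f h"
    by (auto simp: HOM_def homotopies_def intro: derivation_add connects_add)
next
  fix f g h i a b c
  assume "f \<in> Ob (HOM K A B)" "g \<in> Ob (HOM K A B)" "h \<in> Ob (HOM K A B)" "i \<in> Ob (HOM K A B)"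
    "a \<in> Hom (HOM K A B) f g" "b \<in> Hom (HOM K A B) g h" "c \<in> Hom (HOM K A B) h i"
  then show "Comp (HOM K A B) f h i (Comp (HOM K A B) f g h a b) c =
      Comp (HOM K A B) f g i a (Comp (HOM K A B) g h i b c)"
    by (auto simp: HOM_def homotopies_def derivationsD(3) B.M.M.a_assoc intro!: restrict_ext)
next
  fix f
  assume "f \<in> Ob (HOM K A B)"
  then show "Ident (HOM K A B) f \<in> Hom (HOM K A B) f f"
    by (auto simp: HOM_def homotopies_def intro: derivation_zero connects_zero)
next
  fix f g a
  assume "f \<in> Ob (HOM K A B)" "g \<in> Ob (HOM K A B)" "a \<in> Hom (HOM K A B) f g"
  then have f: "f \<in> xmod_maps K A B" and "a \<in> homotopies K A B f g"
    by (auto simp: HOM_def)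
  then obtain s where a: "a = (snd f, s)" and s: "s \<in> derivations K A B (snd f)"
    and c: "connects A B s f g"
    by (auto elim: homotopiesE)
  note s_closed = derivationsD(3)[OF s] and s_ext = derivationsD(2)[OF s]
  show "Comp (HOM K A B) f f g (Ident (HOM K A B) f) a = a"
    "Comp (HOM K A B) f g g a (Ident (HOM K A B) g) = a"
    by (auto simp: HOM_def a fun_eq_iff restrict_def s_closed extensional_arb[OF s_ext])
  show "Inverse (HOM K A B) f g a \<in> Hom (HOM K A B) g f"
    using derivation_neg[OF f s c] connects_neg[OF f s c]
    by (simp add: HOM_def homotopies_def a)
  show "Comp (HOM K A B) f g f a (Inverse (HOM K A B) f g a) = Ident (HOM K A B) f"
    "Comp (HOM K A B) g f g (Inverse (HOM K A B) f g a) a = Ident (HOM K A B) g"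
    using s_closed by (auto simp: HOM_def a B.M.M.r_neg B.M.M.l_neg intro!: restrict_ext)
qed

end

text \<open>Identities, inverses and composition give reflexivity, symmetry and transitivity.\<close>

lemma (in groupoid) equiv_connected:
  "equiv (Ob C) {(f, g). f \<in> Ob C \<and> g \<in> Ob C \<and> Hom C f g \<noteq> {}}"
proof (rule equivI)
  show "refl_on (Ob C) {(f, g). f \<in> Ob C \<and> g \<in> Ob C \<and> Hom C f g \<noteq> {}}"
    using Ident_closed by (fastforce simp: refl_on_def)
  show "sym {(f, g). f \<in> Ob C \<and> g \<in> Ob C \<and> Hom C f g \<noteq> {}}"
    using Inverse_closed by (fastforce simp: sym_def)
  show "trans {(f, g). f \<in> Ob C \<and> g \<in> Ob C \<and> Hom C f g \<noteq> {}}"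
    using Comp_closed by (fastforce simp: trans_def)
qed auto

theorem theorem3p8:
  fixes K :: "('k, 'c) ring_scheme"
    and A :: "('k, 'e, 'r) xmod"
    and A' :: "('k, 'e', 'r') xmod"
  assumes "crossed_module K A"
    and "crossed_module K A'"
  shows "groupoid (HOM K A A') \<and> equiv (xmod_maps K A A') (homotopy_rel K A A')"
proof
  interpret crossed_module_pair K A A'
    using assms by (rule crossed_module_pair.intro)
  show HOM: "groupoid (HOM K A A')"
    by (fact groupoid_HOM)
  have "homotopy_rel K A A' = {(f, g). f \<in> Ob (HOM K A A') \<and> g \<in> Ob (HOM K A A') \<and>
      Hom (HOM K A A') f g \<noteq> {}}"
    by (auto simp: homotopy_rel_def HOM_def homotopies_def)
  then show "equiv (xmod_maps K A A') (homotopy_rel K A A')"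
    using groupoid.equiv_connected[OF HOM] by (simp add: HOM_def)
qed

end
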